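(* Let $\pi$ be a probability density function on $\mathbb{R}^d$ (normalized, $\int\pi(x)\,dx=1$). Let $\tilde\pi\approx\pi$ be an interpolated tensor-train (TT) approximation of $\pi$, and let $\pi^*$ be the TT-CD sampling density, i.e. the density of the samples produced by the conditional distribution (CD) sampler applied to $\tilde\pi$, as defined in the context. Assume that $\pi$ is absolutely continuous with respect to $\pi^*$. Consider the Metropolis--Hastings chain with target density $\pi$ and independence proposals drawn from $\pi^*$ by the TT-CD sampler, with acceptance probability for a move from the current state $x$ to the proposal $x'$ equal to $$\alpha(x,x')=\min\left(\frac{\pi(x')}{\pi(x)}\,\frac{\pi^*(x)}{\pi^*(x')},\,1\right).$$ Suppose that the mean absolute error in the TT-CD sampling density satisfies $$\int |\pi^*(x)-\pi(x)|\,dx\le \varepsilon/2 .$$ Then the rejection rate is bounded by $\varepsilon$, i.e. $$\mathbb{E}\left[1-\alpha(x,x')\right]\le \varepsilon,$$ where the expectation is taken over the chain.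
   Context: **TT approximation.** The approximation $\tilde\pi$ of $\pi$ has the form $$\tilde\pi(x_1,\ldots,x_d)=\sum_{\alpha_0,\ldots,\alpha_d=1}^{r_0,\ldots,r_d}\pi^{(1)}_{\alpha_0,\alpha_1}(x_1)\,\pi^{(2)}_{\alpha_1,\alpha_2}(x_2)\cdots\pi^{(d)}_{\alpha_{d-1},\alpha_d}(x_d),\qquad r_0=r_d=1.$$ The univariate functions $\pi^{(k)}_{\alpha_{k-1},\alpha_k}$ are obtained by piecewise polynomial (e.g. piecewise linear) interpolation, on a univariate grid in each variable, of the blocks of a TT decomposition of the tensor of (approximate) nodal values of $\pi$ on the tensor-product grid. For each fixed $x_k$, $\pi^{(k)}(x_k)$ is regarded as an $r_{k-1}\times r_k$ matrix. The function $\tilde\pi$ may take negative values. **TT-CD sampler and its density $\pi^*$.** Set $P_{d+1}=1$ and, for $k=d,d-1,\ldots,2$, $P_k=\left(\int_{\mathbb{R}}\pi^{(k)}(x_k)\,dx_k\right)P_{k+1}$. Given a seed $(q_1,\ldots,q_d)$ uniformly distributed in $(0,1)^d$, for $k=1,\ldots,d$ in turn, with $x_1,\ldots,x_{k-1}$ already sampled, form $$p_k^*(x_k)=\left|\pi^{(1)}(x_1)\cdots\pi^{(k-1)}(x_{k-1})\,\pi^{(k)}(x_k)\,P_{k+1}\right|,\qquad C_k(x_k)=\frac{\int_{-\infty}^{x_k}p_k^*(y_k)\,dy_k}{\int_{\mathbb{R}} p_k^*(y_k)\,dy_k},$$ and set $x_k=C_k^{-1}(q_k)$. The absolute value ensures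 non-negativity. The TT-CD sampling density $\pi^*$ is the probability density of the resulting sample $x=(x_1,\ldots,x_d)$, that is, the product over $k=1,\ldots,d$ of the functions $p_k^*(x_k)$, each normalized to integrate to $1$ in $x_k$. **Chain.** Given the current state $x$, a proposal $x'$ is drawn from $\pi^*$ independently of $x$; with probability $\alpha(x,x')$ the new state is $x'$, otherwise the chain remains at $x$. The expectation over the chain is the ergodic (equilibrium) one: $$\mathbb{E}\left[1-\alpha(x,x')\right]=\int\!\!\int\left[1-\alpha(x,x')\right]\pi(x)\,\pi^*(x')\,dx\,dx'.$$ *)

theory Defs
  imports "HOL-Probability.Probability" "HOL-Computational_Algebra.Polynomial"
begin

text \<open>
  A point of \<open>\<real>\<^sup>d\<close> is a function on the coordinate set \<open>{1..d}\<close>, so that the order of the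
  variables, on which both the tensor train and the sampler depend, is available.
\<close>

abbreviation lebesgue_Rd :: "nat \<Rightarrow> (nat \<Rightarrow> real) measure" where
  "lebesgue_Rd d \<equiv> (\<Pi>\<^sub>M k\<in>{1..d}. lborel)"

definition prob_density_on :: "'a measure \<Rightarrow> ('a \<Rightarrow> real) \<Rightarrow> bool" where
  "prob_density_on M f \<longleftrightarrow>
     f \<in> borel_measurable M \<and> (\<forall>x\<in>space M. 0 \<le> f x) \<and> integrable M f \<and> (\<integral>x. f x \<partial>M) = 1"

text \<open>
  The argument type \<open>'s\<close> is \<^typ>\<open>nat\<close> for a tensor (argument: multi-index) and
  \<^typ>\<open>real\<close> for a function (argument: point). \<open>G k \<alpha> \<beta>\<close> is the entry in row \<open>\<alpha>\<close> and
  column \<open>\<beta>\<close> of the \<open>k\<close>-th block, with \<open>\<alpha> \<in> {1..r (k - 1)}\<close> and \<open>\<beta> \<in> {1..r k}\<close>.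
\<close>

definition tt_value ::
  "nat \<Rightarrow> (nat \<Rightarrow> nat) \<Rightarrow> (nat \<Rightarrow> nat \<Rightarrow> nat \<Rightarrow> 's \<Rightarrow> real) \<Rightarrow> (nat \<Rightarrow> 's) \<Rightarrow> real" where
  "tt_value d r G x =
     (\<Sum>\<alpha>\<in>(\<Pi>\<^sub>E k\<in>{0..d}. {1..r k}). \<Prod>k=1..d. G k (\<alpha> (k - 1)) (\<alpha> k) (x k))"

text \<open>
  Interpolation of the values \<open>v 0, \<dots>, v n\<close> at the nodes \<open>t 0 < \<dots> < t n\<close> by a function that is
  polynomial on every grid cell (of any degree; piecewise linear is the case of degree at
  most 1) and extended by zero to the real line.
\<close>

definition piecewise_poly_interpolant ::
  "nat \<Rightarrow> (nat \<Rightarrow> real) \<Rightarrow> (nat \<Rightarrow> real) \<Rightarrow> (real \<Rightarrow> real) \<Rightarrow> bool" where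
  "piecewise_poly_interpolant n t v f \<longleftrightarrow>
     (\<forall>j\<le>n. f (t j) = v j) \<and>
     (\<forall>j<n. \<exists>p :: real poly. \<forall>y\<in>{t j..t (Suc j)}. f y = poly p y) \<and>
     (\<forall>y. y \<notin> {t 0..t n} \<longrightarrow> f y = 0)"

text \<open>
  \<open>A\<close> is the tensor of approximate nodal values, on the grid with nodes
  \<open>t k 0 < \<dots> < t k (n k)\<close> in the variable \<open>k\<close>, and \<open>V\<close> are the blocks of its TT decomposition.
  How well \<open>A\<close> approximates the nodal values is not quantified.
\<close>

definition interpolated_tt ::
  "nat \<Rightarrow> (nat \<Rightarrow> nat) \<Rightarrow> (nat \<Rightarrow> nat) \<Rightarrow> (nat \<Rightarrow> nat \<Rightarrow> real) \<Rightarrow> ((nat \<Rightarrow> nat) \<Rightarrow> real) \<Rightarrow>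
   (nat \<Rightarrow> nat \<Rightarrow> nat \<Rightarrow> real \<Rightarrow> real) \<Rightarrow> ((nat \<Rightarrow> real) \<Rightarrow> real) \<Rightarrow> bool" where
  "interpolated_tt d r n t A G f \<longleftrightarrow>
     r 0 = 1 \<and> r d = 1 \<and> (\<forall>k\<le>d. 1 \<le> r k) \<and>
     (\<forall>k\<in>{1..d}. 1 \<le> n k \<and> strict_mono_on {0..n k} (t k)) \<and>
     (\<exists>V :: nat \<Rightarrow> nat \<Rightarrow> nat \<Rightarrow> nat \<Rightarrow> real.
        (\<forall>j\<in>(\<Pi>\<^sub>E k\<in>{1..d}. {0..n k}). A j = tt_value d r V j) \<and>
        (\<forall>k\<in>{1..d}. \<forall>\<alpha>\<in>{1..r (k - 1)}. \<forall>\<beta>\<in>{1..r k}.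
           piecewise_poly_interpolant (n k) (t k) (V k \<alpha> \<beta>) (G k \<alpha> \<beta>))) \<and>
     (\<forall>x\<in>space (lebesgue_Rd d). f x = tt_value d r G x)"

text \<open>Entry \<open>\<beta>\<close> of the row vector \<open>G\<^sup>(\<^sup>1\<^sup>)(x\<^sub>1) \<cdots> G\<^sup>(\<^sup>k\<^sup>)(x\<^sub>k)\<close>.\<close>

primrec tt_left ::
  "(nat \<Rightarrow> nat) \<Rightarrow> (nat \<Rightarrow> nat \<Rightarrow> nat \<Rightarrow> real \<Rightarrow> real) \<Rightarrow> (nat \<Rightarrow> real) \<Rightarrow> nat \<Rightarrow> nat \<Rightarrow> real" where
  "tt_left r G x 0 \<beta> = 1"
| "tt_left r G x (Suc k) \<beta> = (\<Sum>\<alpha>=1..r k. tt_left r G x k \<alpha> * G (Suc k) \<alpha> \<beta> (x (Suc k)))"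

text \<open>Entry \<open>\<alpha>\<close> of the column vector \<open>P\<^sub>k\<close>, with \<open>P\<^sub>d\<^sub>+\<^sub>1 = 1\<close>.\<close>

function tt_tail ::
  "nat \<Rightarrow> (nat \<Rightarrow> nat) \<Rightarrow> (nat \<Rightarrow> nat \<Rightarrow> nat \<Rightarrow> real \<Rightarrow> real) \<Rightarrow> nat \<Rightarrow> nat \<Rightarrow> real" where
  "tt_tail d r G k \<alpha> =
     (if d < k then 1
      else (\<Sum>\<beta>=1..r k. (\<integral>y. G k \<alpha> \<beta> y \<partial>lborel) * tt_tail d r G (Suc k) \<beta>))"
  by pat_completeness auto
termination
  by (relation "Wellfounded.measure (\<lambda>(d, r, G, k, \<alpha>). Suc d - k)") auto

declare tt_tail.simps [simp del]

text \<open>\<open>p\<^sup>*\<^sub>k(y)\<close>, given the coordinates \<open>x\<^sub>1, \<dots>, x\<^sub>k\<^sub>-\<^sub>1\<close> of \<open>x\<close>.\<close>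

definition cd_conditional ::
  "nat \<Rightarrow> (nat \<Rightarrow> nat) \<Rightarrow> (nat \<Rightarrow> nat \<Rightarrow> nat \<Rightarrow> real \<Rightarrow> real) \<Rightarrow> nat \<Rightarrow> (nat \<Rightarrow> real) \<Rightarrow> real \<Rightarrow> real"
  where
  "cd_conditional d r G k x y =
     \<bar>\<Sum>\<alpha>=1..r (k - 1). \<Sum>\<beta>=1..r k.
        tt_left r G x (k - 1) \<alpha> * G k \<alpha> \<beta> y * tt_tail d r G (Suc k) \<beta>\<bar>"

text \<open>
  Inverting the conditional distribution function \<open>C\<^sub>k\<close> at a uniform seed yields a sample with
  conditional density \<open>p\<^sup>*\<^sub>k / \<integral> p\<^sup>*\<^sub>k\<close>, hence the product. If \<open>p\<^sup>*\<^sub>k\<close> has integral 0, division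
  by zero makes the density 0. For \<open>k = 1\<close> this is incompatible with the absolute continuity of a
  probability density with respect to it, and for \<open>k > 1\<close> it only happens where
  \<open>p\<^sup>*\<^sub>k\<^sub>-\<^sub>1(x\<^sub>k\<^sub>-\<^sub>1) = 0\<close>, that is, where the density is 0 already.
\<close>

definition tt_cd_density ::
  "nat \<Rightarrow> (nat \<Rightarrow> nat) \<Rightarrow> (nat \<Rightarrow> nat \<Rightarrow> nat \<Rightarrow> real \<Rightarrow> real) \<Rightarrow> (nat \<Rightarrow> real) \<Rightarrow> real" where
  "tt_cd_density d r G x =
     (\<Prod>k=1..d. cd_conditional d r G k x (x k) / (\<integral>y. cd_conditional d r G k x y \<partial>lborel))"

text \<open>
  Acceptance probability of a move from \<open>x\<close> to \<open>x'\<close> under target density \<open>f\<close> and independence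
  proposal density \<open>g\<close>. Its values where \<open>f x = 0\<close> or \<open>g x' = 0\<close>, which depend on division by
  zero, carry weight 0 in the rejection rate.
\<close>

definition mh_acceptance :: "('a \<Rightarrow> real) \<Rightarrow> ('a \<Rightarrow> real) \<Rightarrow> 'a \<Rightarrow> 'a \<Rightarrow> real" where
  "mh_acceptance f g x x' = min ((f x' / f x) * (g x / g x')) 1"

definition mh_rejection_rate :: "'a measure \<Rightarrow> ('a \<Rightarrow> real) \<Rightarrow> ('a \<Rightarrow> real) \<Rightarrow> real" where
  "mh_rejection_rate M f g =
     (\<integral>x. (\<integral>x'. (1 - mh_acceptance f g x x') * f x * g x' \<partial>M) \<partial>M)"

end

theory Submission
  imports Defs
begin

text \<open>
  The rejection rate is at most the \<open>L\<^sup>1\<close> distance between target and proposal density, which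
  is at most \<open>\<epsilon> / 2\<close>, and \<open>\<epsilon> / 2 \<le> \<epsilon>\<close> because a distance is nonnegative. Where no denominator vanishes,
  \<open>(1 - \<alpha>(x,x')) \<pi>(x) \<pi>\<^sup>*(x')\<close> is the positive part of
  \<open>\<pi>(x) \<pi>\<^sup>*(x') - \<pi>(x') \<pi>\<^sup>*(x) = \<pi>(x) (\<pi>\<^sup>*(x') - \<pi>(x')) + \<pi>(x') (\<pi>(x) - \<pi>\<^sup>*(x))\<close>.
  Bounding it by the sum of the positive parts of the two terms separates the variables, and since
  \<open>\<pi>\<close> has integral 1, the double integral of this bound is
  \<open>\<integral> (\<pi>\<^sup>* - \<pi>)\<^sub>+ + \<integral> (\<pi> - \<pi>\<^sup>*)\<^sub>+ = \<integral> \<bar>\<pi>\<^sup>* - \<pi>\<bar>\<close>. This is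
  \<open>mh_rejection_rate_le_L1_distance\<close>, valid on any measure space.

  That estimate presupposes that \<open>\<pi>\<^sup>*\<close> is integrable: the integral of a non-integrable function
  is 0 by convention, so a small value of \<open>\<integral> \<bar>\<pi>\<^sup>* - \<pi>\<bar>\<close> would otherwise say nothing. For the TT-CD
  density, measurability comes down to that of the univariate blocks, which are piecewise
  polynomial. The integral is at most 1 because the \<open>k\<close>-th factor of the density depends only on
  \<open>x\<^sub>1, \<dots>, x\<^sub>k\<close> and is normalized in \<open>x\<^sub>k\<close>, so the variables can be integrated out from the last
  to the first (\<open>nn_integral_prod_cd_conditional_density_le_1\<close>).
\<close>

section \<open>Rejection and the \<open>L\<^sup>1\<close> distance\<close>

text \<open>
  Each summand of the bound is a function of \<open>x\<close> times a function of \<open>x'\<close>, which makes the iterated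
  integrals explicit.
\<close>

lemma mh_rejection_integrand_le:
  assumes "0 \<le> f x" "0 \<le> f x'" "0 \<le> g x" "0 \<le> g x'"
  shows "(1 - mh_acceptance f g x x') * f x * g x'
           \<le> f x * max 0 (g x' - f x') + f x' * max 0 (f x - g x)"
proof (cases "f x = 0 \<or> g x' = 0")
  \<comment> \<open>The weight \<open>f x * g x'\<close> vanishes, whatever value division by zero gives to the acceptance.\<close>
  case True
  then show ?thesis using assms by auto
next
  case False
  then have pos: "0 < f x" "0 < g x'" using assms by auto
  have "(1 - mh_acceptance f g x x') * f x * g x'
          = max 0 (1 - f x' / f x * (g x / g x')) * (f x * g x')"
    by (simp add: mh_acceptance_def min_def max_def)
  also have "\<dots> = max 0 ((1 - f x' / f x * (g x / g x')) * (f x * g x'))"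
    using pos by (simp add: max_mult_distrib_right)
  also have "(1 - f x' / f x * (g x / g x')) * (f x * g x') = f x * g x' - f x' * g x"
    using pos by (simp add: field_simps)
  also have "f x * g x' - f x' * g x = f x * (g x' - f x') + f x' * (f x - g x)"
    by (simp add: algebra_simps)
  also have "max 0 \<dots> \<le> f x * max 0 (g x' - f x') + f x' * max 0 (f x - g x)"
    using assms by (intro max.boundedI add_mono add_nonneg_nonneg mult_left_mono) auto
  finally show ?thesis .
qed

text \<open>
  The double integral is monotone in its integrand because the bound is nonnegative and integrable
  in each variable in turn; this holds even for an integrand whose own integral is 0 by convention.
\<close>

lemma mh_rejection_rate_le_L1_distance:
  assumes f: "prob_density_on M f"
    and g: "integrable M g" "\<And>x. x \<in> space M \<Longrightarrow> 0 \<le> g x"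
  shows "mh_rejection_rate M f g \<le> (\<integral>x. \<bar>g x - f x\<bar> \<partial>M)"
proof -
  have f_int: "integrable M f" and f_1: "(\<integral>x. f x \<partial>M) = 1"
    and f_nonneg: "\<And>x. x \<in> space M \<Longrightarrow> 0 \<le> f x"
    using f by (auto simp: prob_density_on_def)
  define a where "a = (\<integral>x. max 0 (g x - f x) \<partial>M)"
  have gf: "integrable M (\<lambda>x. max 0 (g x - f x))" and fg: "integrable M (\<lambda>x. max 0 (f x - g x))"
    using f_int g(1) by auto
  have a_nonneg: "0 \<le> a"
    by (simp add: a_def integral_nonneg_AE)
  have inner: "(\<integral>x'. (1 - mh_acceptance f g x x') * f x * g x' \<partial>M) \<le> a * f x + max 0 (f x - g x)"
    if x: "x \<in> space M" for x
  proof -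
    have "(\<integral>x'. (1 - mh_acceptance f g x x') * f x * g x' \<partial>M)
            \<le> (\<integral>x'. f x * max 0 (g x' - f x') + f x' * max 0 (f x - g x) \<partial>M)"
      using x gf f_int f_nonneg g(2)
      by (intro integral_mono' mh_rejection_integrand_le) (auto intro!: add_nonneg_nonneg)
    also have "\<dots> = a * f x + max 0 (f x - g x)"
      using gf f_int by (simp add: a_def f_1)
    finally show ?thesis .
  qed
  have "mh_rejection_rate M f g \<le> (\<integral>x. a * f x + max 0 (f x - g x) \<partial>M)"
    unfolding mh_rejection_rate_def
    using inner f_int fg f_nonneg a_nonneg by (intro integral_mono') (auto intro!: add_nonneg_nonneg)
  also have "\<dots> = (\<integral>x. max 0 (g x - f x) \<partial>M) + (\<integral>x. max 0 (f x - g x) \<partial>M)"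
    using f_int fg by (simp add: a_def f_1)
  also have "\<dots> = (\<integral>x. max 0 (g x - f x) + max 0 (f x - g x) \<partial>M)"
    using gf fg by simp
  also have "\<dots> = (\<integral>x. \<bar>g x - f x\<bar> \<partial>M)"
    by (intro Bochner_Integration.integral_cong) auto
  finally show ?thesis .
qed

section \<open>Measurability of the interpolated blocks\<close>

lemma grid_cells_cover:
  fixes t :: "nat \<Rightarrow> real"
  assumes "1 \<le> n" "y \<in> {t 0..t n}"
  shows "\<exists>j<n. y \<in> {t j..t (Suc j)}"
  using assms
proof (induction n rule: dec_induct)
  case base
  then show ?case by auto
next
  case (step n)
  then show ?case
    by (cases "y \<le> t n") (auto intro: less_SucI)
qed

text \<open>
  The finitely many grid cells and the complement of the grid cover the line, and on each of these
  sets the interpolant coincides with a polynomial.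
\<close>

lemma borel_measurable_piecewise_poly_interpolant:
  assumes "piecewise_poly_interpolant n t v f" "1 \<le> n"
  shows "f \<in> borel_measurable borel"
proof (rule measurable_piecewise_restrict)
  let ?C = "insert (- {t 0..t n}) ((\<lambda>j. {t j..t (Suc j)}) ` {..<n})"
  show "countable ?C" by simp
  show "space borel \<subseteq> \<Union>?C"
  proof
    fix y
    show "y \<in> \<Union>?C"
      using grid_cells_cover[OF assms(2), of y t] by (cases "y \<in> {t 0..t n}") auto
  qed
  fix S assume S: "S \<in> ?C"
  then show "S \<inter> space borel \<in> sets borel" by auto
  consider "S = - {t 0..t n}" | j where "j < n" "S = {t j..t (Suc j)}"
    using S by blast
  then show "f \<in> borel_measurable (restrict_space borel S)"
  proof cases
    case 1
    have "(\<lambda>_. 0) \<in> borel_measurable (restrict_space borel S)" by simp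
    then show ?thesis
      by (rule measurable_cong[THEN iffD1, rotated])
        (use 1 assms in \<open>auto simp: space_restrict_space piecewise_poly_interpolant_def\<close>)
  next
    case 2
    then obtain p where p: "\<And>y. y \<in> S \<Longrightarrow> f y = poly p y"
      using assms by (auto simp: piecewise_poly_interpolant_def)
    have "poly p \<in> borel_measurable (restrict_space borel S)"
      by (intro measurable_restrict_space1 borel_measurable_continuous_onI continuous_on_poly continuous_on_id)
    then show ?thesis
      by (rule measurable_cong[THEN iffD1, rotated]) (auto simp: space_restrict_space p)
  qed
qed

section \<open>The conditional distribution sampler\<close>

text \<open>
  The sampler is sequential: neither the \<open>k\<close>-th conditional nor its normalizing constant involves
  the coordinates from \<open>k\<close> on, the \<open>k\<close>-th one entering only through the separate argument \<open>y\<close>.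
\<close>

lemma tt_left_fun_upd:
  "k < i \<Longrightarrow> tt_left r G (x(i := y)) k \<beta> = tt_left r G x k \<beta>"
  by (induction k arbitrary: \<beta>) auto

lemma cd_conditional_fun_upd:
  "k \<le> i \<Longrightarrow> 1 \<le> k \<Longrightarrow> cd_conditional d r G k (x(i := y)) = cd_conditional d r G k x"
  by (auto simp: cd_conditional_def tt_left_fun_upd fun_eq_iff)

text \<open>
  Measurability is stated on \<open>\<real>\<^sup>m\<close> for every \<open>m\<close> between the number of blocks involved and \<open>d\<close>,
  since the integration over one variable after another passes through all these spaces.
\<close>

lemma borel_measurable_tt_left:
  assumes G: "\<And>k \<alpha> \<beta>. k \<in> {1..d} \<Longrightarrow> \<alpha> \<in> {1..r (k - 1)} \<Longrightarrow> \<beta> \<in> {1..r k}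
                \<Longrightarrow> G k \<alpha> \<beta> \<in> borel_measurable borel"
    and "k \<le> m" "m \<le> d" "\<beta> \<in> {1..r k}"
  shows "(\<lambda>x. tt_left r G x k \<beta>) \<in> borel_measurable (lebesgue_Rd m)"
  using assms(2-)
proof (induction k arbitrary: \<beta>)
  case (Suc k)
  have proj: "(\<lambda>x. x (Suc k)) \<in> lebesgue_Rd m \<rightarrow>\<^sub>M borel"
    using Suc.prems measurable_component_singleton[of "Suc k" "{1..m}" "\<lambda>_. lborel"] by simp
  have "(\<lambda>x. G (Suc k) \<alpha> \<beta> (x (Suc k))) \<in> borel_measurable (lebesgue_Rd m)"
    if "\<alpha> \<in> {1..r k}" for \<alpha>
    using Suc.prems that by (intro measurable_compose[OF proj] G) auto
  then show ?case using Suc by auto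
qed simp

lemma borel_measurable_cd_conditional:
  assumes G: "\<And>k \<alpha> \<beta>. k \<in> {1..d} \<Longrightarrow> \<alpha> \<in> {1..r (k - 1)} \<Longrightarrow> \<beta> \<in> {1..r k}
                \<Longrightarrow> G k \<alpha> \<beta> \<in> borel_measurable borel"
    and k: "k \<in> {1..d}" "k - 1 \<le> m" "m \<le> d"
  shows "(\<lambda>(x, y). cd_conditional d r G k x y) \<in> borel_measurable (lebesgue_Rd m \<Otimes>\<^sub>M lborel)"
proof -
  have "(\<lambda>z. tt_left r G (fst z) (k - 1) \<alpha>) \<in> borel_measurable (lebesgue_Rd m \<Otimes>\<^sub>M lborel)"
    if "\<alpha> \<in> {1..r (k - 1)}" for \<alpha>
    using that k by (intro measurable_compose[OF measurable_fst borel_measurable_tt_left[OF G]]) auto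
  moreover have "(\<lambda>z. G k \<alpha> \<beta> (snd z)) \<in> borel_measurable (lebesgue_Rd m \<Otimes>\<^sub>M lborel)"
    if "\<alpha> \<in> {1..r (k - 1)}" "\<beta> \<in> {1..r k}" for \<alpha> \<beta>
    using that k by (intro measurable_compose[OF measurable_snd]) (simp add: G)
  ultimately show ?thesis
    unfolding cd_conditional_def case_prod_beta
    by (intro borel_measurable_abs borel_measurable_sum borel_measurable_times) auto
qed

definition cd_conditional_density ::
  "nat \<Rightarrow> (nat \<Rightarrow> nat) \<Rightarrow> (nat \<Rightarrow> nat \<Rightarrow> nat \<Rightarrow> real \<Rightarrow> real) \<Rightarrow> nat \<Rightarrow> (nat \<Rightarrow> real) \<Rightarrow> real \<Rightarrow> real"
  where
  "cd_conditional_density d r G k x y =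
     cd_conditional d r G k x y / (\<integral>z. cd_conditional d r G k x z \<partial>lborel)"

lemma cd_conditional_density_nonneg: "0 \<le> cd_conditional_density d r G k x y"
  by (simp add: cd_conditional_density_def cd_conditional_def)

lemma cd_conditional_density_fun_upd:
  "k \<le> i \<Longrightarrow> 1 \<le> k \<Longrightarrow> cd_conditional_density d r G k (x(i := y)) = cd_conditional_density d r G k x"
  by (simp add: cd_conditional_density_def cd_conditional_fun_upd fun_eq_iff)

lemma tt_cd_density_eq_prod_cd_conditional_density:
  "tt_cd_density d r G x = (\<Prod>k=1..d. cd_conditional_density d r G k x (x k))"
  by (simp add: tt_cd_density_def cd_conditional_density_def)

text \<open>
  Only an inequality, because of the degenerate case: if \<open>h\<close> has integral 0 or is not integrable,
  the normalizing constant is 0, and so is every quotient by it.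
\<close>

lemma nn_integral_normalized_le_1:
  assumes "\<And>y. 0 \<le> h y"
  shows "(\<integral>\<^sup>+y. ennreal (h y / (\<integral>z. h z \<partial>M)) \<partial>M) \<le> 1"
proof (cases "(\<integral>z. h z \<partial>M) = 0")
  case False
  then have int: "integrable M h" using not_integrable_integral_eq by blast
  then have "(\<integral>\<^sup>+y. ennreal (h y / (\<integral>z. h z \<partial>M)) \<partial>M) = ennreal (\<integral>y. h y / (\<integral>z. h z \<partial>M) \<partial>M)"
    using assms by (intro nn_integral_eq_integral) auto
  then show ?thesis using False by simp
qed simp

lemma borel_measurable_cd_conditional_density:
  assumes G: "\<And>k \<alpha> \<beta>. k \<in> {1..d} \<Longrightarrow> \<alpha> \<in> {1..r (k - 1)} \<Longrightarrow> \<beta> \<in> {1..r k}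
                \<Longrightarrow> G k \<alpha> \<beta> \<in> borel_measurable borel"
    and k: "k \<in> {1..m}" "m \<le> d"
  shows "(\<lambda>x. cd_conditional_density d r G k x (x k)) \<in> borel_measurable (lebesgue_Rd m)"
proof -
  have meas: "(\<lambda>(x, y). cd_conditional d r G k x y) \<in> borel_measurable (lebesgue_Rd m \<Otimes>\<^sub>M lborel)"
    using k by (intro borel_measurable_cd_conditional[OF G]) auto
  have "(\<lambda>x. (x, x k)) \<in> lebesgue_Rd m \<rightarrow>\<^sub>M lebesgue_Rd m \<Otimes>\<^sub>M lborel"
    using k by (intro measurable_Pair measurable_component_singleton) auto
  from measurable_compose[OF this meas]
  have "(\<lambda>x. cd_conditional d r G k x (x k)) \<in> borel_measurable (lebesgue_Rd m)" by simp
  moreover have "(\<lambda>x. \<integral>z. cd_conditional d r G k x z \<partial>lborel) \<in> borel_measurable (lebesgue_Rd m)"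
    using meas by (rule lborel.borel_measurable_lebesgue_integral)
  ultimately show ?thesis unfolding cd_conditional_density_def by simp
qed

text \<open>
  Induction on the number of coordinates, splitting off the last one: the factors for the earlier
  coordinates are constant in it, and the last factor integrates to at most 1.
\<close>

lemma nn_integral_prod_cd_conditional_density_le_1:
  assumes G: "\<And>k \<alpha> \<beta>. k \<in> {1..d} \<Longrightarrow> \<alpha> \<in> {1..r (k - 1)} \<Longrightarrow> \<beta> \<in> {1..r k}
                \<Longrightarrow> G k \<alpha> \<beta> \<in> borel_measurable borel"
    and "m \<le> d"
  shows "(\<integral>\<^sup>+x. ennreal (\<Prod>k=1..m. cd_conditional_density d r G k x (x k)) \<partial>lebesgue_Rd m) \<le> 1"
  using assms(2)
proof (induction m)
  case 0
  show ?case by (simp add: space_PiM_empty)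
next
  case (Suc m)
  interpret product_sigma_finite "\<lambda>_::nat. lborel :: real measure"
    by standard
  let ?F = "\<lambda>m x. \<Prod>k=1..m. cd_conditional_density d r G k x (x k)"
  have ins: "{1..Suc m} = insert (Suc m) {1..m}" by auto
  have split: "?F (Suc m) (x(Suc m := y)) = ?F m x * cd_conditional_density d r G (Suc m) x y" for x y
  proof -
    have "?F m (x(Suc m := y)) = ?F m x"
      by (intro prod.cong) (auto simp: cd_conditional_density_fun_upd)
    then show ?thesis by (simp add: cd_conditional_density_fun_upd)
  qed
  have "(\<lambda>x. ennreal (?F (Suc m) x)) \<in> borel_measurable (lebesgue_Rd (Suc m))"
    using Suc.prems borel_measurable_cd_conditional_density[where m = "Suc m", OF G]
    by (intro measurable_compose[OF _ measurable_ennreal] borel_measurable_prod) auto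
  then have "(\<integral>\<^sup>+x. ennreal (?F (Suc m) x) \<partial>lebesgue_Rd (Suc m))
      = (\<integral>\<^sup>+x. (\<integral>\<^sup>+y. ennreal (?F (Suc m) (x(Suc m := y))) \<partial>lborel) \<partial>lebesgue_Rd m)"
    unfolding ins by (subst product_nn_integral_insert) auto
  also have "\<dots> \<le> (\<integral>\<^sup>+x. ennreal (?F m x) \<partial>lebesgue_Rd m)"
  proof (rule nn_integral_mono)
    fix x assume x: "x \<in> space (lebesgue_Rd m)"
    have "cd_conditional d r G (Suc m) x \<in> borel_measurable lborel"
      using measurable_compose[OF measurable_Pair1'[OF x]
          borel_measurable_cd_conditional[where k = "Suc m" and m = m, OF G]] Suc.prems by simp
    then have meas: "cd_conditional_density d r G (Suc m) x \<in> borel_measurable lborel"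
      unfolding cd_conditional_density_def by simp
    have "(\<integral>\<^sup>+y. ennreal (?F (Suc m) (x(Suc m := y))) \<partial>lborel)
        = (\<integral>\<^sup>+y. ennreal (?F m x) * ennreal (cd_conditional_density d r G (Suc m) x y) \<partial>lborel)"
      by (simp only: split ennreal_mult prod_nonneg cd_conditional_density_nonneg)
    also have "\<dots> = ennreal (?F m x) * (\<integral>\<^sup>+y. ennreal (cd_conditional_density d r G (Suc m) x y) \<partial>lborel)"
      using meas by (intro nn_integral_cmult) auto
    also have "\<dots> \<le> ennreal (?F m x) * 1"
      unfolding cd_conditional_density_def
      by (intro mult_left_mono nn_integral_normalized_le_1) (auto simp: cd_conditional_def)
    finally show "(\<integral>\<^sup>+y. ennreal (?F (Suc m) (x(Suc m := y))) \<partial>lborel) \<le> ennreal (?F m x)"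
      by simp
  qed
  also have "\<dots> \<le> 1" using Suc by simp
  finally show ?case .
qed

lemma integrable_tt_cd_density:
  assumes G: "\<And>k \<alpha> \<beta>. k \<in> {1..d} \<Longrightarrow> \<alpha> \<in> {1..r (k - 1)} \<Longrightarrow> \<beta> \<in> {1..r k}
                \<Longrightarrow> G k \<alpha> \<beta> \<in> borel_measurable borel"
  shows "integrable (lebesgue_Rd d) (tt_cd_density d r G)"
proof (rule integrableI_nonneg)
  show "tt_cd_density d r G \<in> borel_measurable (lebesgue_Rd d)"
    unfolding tt_cd_density_eq_prod_cd_conditional_density
    using borel_measurable_cd_conditional_density[where m = d, OF G] by (intro borel_measurable_prod) auto
  show "AE x in lebesgue_Rd d. 0 \<le> tt_cd_density d r G x"
    by (simp add: tt_cd_density_eq_prod_cd_conditional_density prod_nonneg cd_conditional_density_nonneg)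
  have "(\<integral>\<^sup>+x. ennreal (tt_cd_density d r G x) \<partial>lebesgue_Rd d) \<le> 1"
    unfolding tt_cd_density_eq_prod_cd_conditional_density by (rule nn_integral_prod_cd_conditional_density_le_1[OF G]) auto
  also have "\<dots> < \<infinity>" by simp
  finally show "(\<integral>\<^sup>+x. ennreal (tt_cd_density d r G x) \<partial>lebesgue_Rd d) < \<infinity>" .
qed

theorem lemma1:
  fixes d :: nat
    and r n :: "nat \<Rightarrow> nat"
    and t :: "nat \<Rightarrow> nat \<Rightarrow> real"
    and A :: "(nat \<Rightarrow> nat) \<Rightarrow> real"
    and G :: "nat \<Rightarrow> nat \<Rightarrow> nat \<Rightarrow> real \<Rightarrow> real"
    and \<pi> \<pi>_tilde \<pi>_star :: "(nat \<Rightarrow> real) \<Rightarrow> real"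
    and \<epsilon> :: real
  assumes "1 \<le> d"
    and "prob_density_on (lebesgue_Rd d) \<pi>"
    and "interpolated_tt d r n t A G \<pi>_tilde"
    and "\<pi>_star = tt_cd_density d r G"
    and "absolutely_continuous
           (density (lebesgue_Rd d) (\<lambda>x. ennreal (\<pi>_star x)))
           (density (lebesgue_Rd d) (\<lambda>x. ennreal (\<pi> x)))"
    and "(\<integral>x. \<bar>\<pi>_star x - \<pi> x\<bar> \<partial>lebesgue_Rd d) \<le> \<epsilon> / 2"
  shows "mh_rejection_rate (lebesgue_Rd d) \<pi> \<pi>_star \<le> \<epsilon>"
proof -
  have G: "G k \<alpha> \<beta> \<in> borel_measurable borel"
    if "k \<in> {1..d}" "\<alpha> \<in> {1..r (k - 1)}" "\<beta> \<in> {1..r k}" for k \<alpha> \<beta>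
    using assms(3) that unfolding interpolated_tt_def
    by (blast intro: borel_measurable_piecewise_poly_interpolant)
  have "mh_rejection_rate (lebesgue_Rd d) \<pi> \<pi>_star
          \<le> (\<integral>x. \<bar>\<pi>_star x - \<pi> x\<bar> \<partial>lebesgue_Rd d)"
    unfolding assms(4)
    by (rule mh_rejection_rate_le_L1_distance[OF assms(2) integrable_tt_cd_density[OF G]])
      (auto simp: tt_cd_density_eq_prod_cd_conditional_density intro!: prod_nonneg cd_conditional_density_nonneg)
  moreover have "0 \<le> (\<integral>x. \<bar>\<pi>_star x - \<pi> x\<bar> \<partial>lebesgue_Rd d)" by simp
  ultimately show ?thesis using assms(6) by linarith
qed

end
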